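(* For all integers $n \geq 0$ and all real $x$, $$c_n(x) = (-1)^n n! \sum_{m=0}^n \frac{\widehat{c}_m}{m!} \binom{x+n-1}{n-m}$$ and $$\widehat{c}_n(x) = n! \sum_{m=0}^n \frac{(-1)^m \, c_m}{m!} \binom{x-m}{n-m}.$$
   Context: For real $z$ and integer $n\ge 0$, $\binom{z}{n} = \frac{z(z-1)\cdots(z-n+1)}{n!}$ (with $\binom{z}{0}=1$). The Cauchy polynomials of the first and second kind are $c_n(x) = n! \int_{0}^{1} \binom{t - x}{n}\, dt$ and $\widehat{c}_n(x) = n! \int_{0}^{1} \binom{x - t}{n}\, dt$, $n \ge 0$; the Cauchy numbers are $c_n = c_n(0)$ and $\widehat{c}_n=\widehat{c}_n(0)$. *)

theory Defs
  imports "HOL-Analysis.Analysis"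
begin

text \<open>
  Integrals are Henstock--Kurzweil integrals; the integrands below are polynomials in \<open>t\<close>,
  hence integrable.
\<close>

definition cauchy_poly1 :: "nat \<Rightarrow> real \<Rightarrow> real" where
  "cauchy_poly1 n x = fact n * integral {0..1} (\<lambda>t. (t - x) gchoose n)"

definition cauchy_poly2 :: "nat \<Rightarrow> real \<Rightarrow> real" where
  "cauchy_poly2 n x = fact n * integral {0..1} (\<lambda>t. (x - t) gchoose n)"

definition cauchy_num1 :: "nat \<Rightarrow> real" where
  "cauchy_num1 n = cauchy_poly1 n 0"

definition cauchy_num2 :: "nat \<Rightarrow> real" where
  "cauchy_num2 n = cauchy_poly2 n 0"

end

theory Submission
  imports Defs
begin

text \<open>
  Both identities are integrated forms of Vandermonde's convolution: by negating the upper index,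
  \<open>(t - x) gchoose n\<close> becomes \<open>(-1) ^ n\<close> times \<open>(-t + (x + n - 1)) gchoose n\<close>, and
  \<open>(x - t) gchoose n\<close> becomes \<open>(-1) ^ n\<close> times \<open>(t + (n - 1 - x)) gchoose n\<close>; in the latter
  case the remaining factors are negated back after expanding.
\<close>

text \<open>Keeping \<open>- t\<close> as a separate summand of the upper index makes each
  \<open>- t gchoose m\<close> integrate over [0,1] to
  \<open>cauchy_num2 m / fact m\<close>.\<close>

lemma gchoose_diff_expand_neg:
  fixes t x :: "'a :: field_char_0"
  shows "(t - x) gchoose n =
    (-1) ^ n * (\<Sum>m=0..n. (- t gchoose m) * ((x + of_nat n - 1) gchoose (n - m)))"
proof -
  have "(t - x) gchoose n = (-1) ^ n * ((- t + (x + of_nat n - 1)) gchoose n)"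
    by (subst gbinomial_negated_upper) (simp add: algebra_simps)
  then show ?thesis
    by (simp only: gbinomial_Vandermonde)
qed

text \<open>Splitting \<open>x + (- t)\<close> directly would lead to numbers of the second kind;
  negating first leaves \<open>t\<close> with a positive sign, hence the first kind.\<close>

lemma gchoose_diff_expand:
  fixes t x :: "'a :: field_char_0"
  shows "(x - t) gchoose n =
    (\<Sum>m=0..n. (-1) ^ m * (t gchoose m) * ((x - of_nat m) gchoose (n - m)))"
proof -
  have "(x - t) gchoose n = (-1) ^ n * ((t + (of_nat n - 1 - x)) gchoose n)"
    by (subst gbinomial_negated_upper) (simp add: algebra_simps)
  also have "\<dots> = (\<Sum>m=0..n. (-1) ^ n * ((t gchoose m) * ((of_nat n - 1 - x) gchoose (n - m))))"
    by (subst gbinomial_Vandermonde[symmetric]) (rule sum_distrib_left)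
  also have "\<dots> = (\<Sum>m=0..n. (-1) ^ m * (t gchoose m) * ((x - of_nat m) gchoose (n - m)))"
  proof (rule sum.cong[OF refl])
    fix m assume "m \<in> {0..n}"
    then obtain k where n: "n = m + k"
      by (auto simp: le_iff_add)
    \<comment> \<open>Since \<open>n = m + k\<close>, the negated index
      \<open>k - (n - 1 - x) - 1\<close> equals \<open>x - m\<close>, and this sign
      \<open>(-1) ^ k\<close> reduces \<open>(-1) ^ n\<close> to \<open>(-1) ^ m\<close>.\<close>
    have "(of_nat n - 1 - x) gchoose k = (-1) ^ k * ((x - of_nat m) gchoose k)"
      by (subst gbinomial_negated_upper) (simp add: n)
    then show "(-1) ^ n * ((t gchoose m) * ((of_nat n - 1 - x) gchoose (n - m))) =
        (-1) ^ m * (t gchoose m) * ((x - of_nat m) gchoose (n - m))"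
      by (simp add: n power_add mult.assoc mult.left_commute[of "(-1) ^ k"])
  qed
  finally show ?thesis .
qed

text \<open>The product form of the binomial coefficient exposes a polynomial in \<open>f t\<close>,
  so continuity carries over.\<close>

lemma gchoose_integrable_on:
  fixes f :: "real \<Rightarrow> real"
  assumes "continuous_on {a..b} f"
  shows "(\<lambda>t. f t gchoose n) integrable_on {a..b}"
  unfolding gbinomial_prod_rev
  by (intro integrable_continuous_real continuous_intros assms) simp

theorem theorem2:
  fixes n :: nat and x :: real
  shows "cauchy_poly1 n x =
           (-1) ^ n * fact n *
             (\<Sum>m=0..n. cauchy_num2 m / fact m * ((x + real n - 1) gchoose (n - m)))
       \<and> cauchy_poly2 n x =
           fact n *
             (\<Sum>m=0..n. (-1) ^ m * cauchy_num1 m / fact m * ((x - real m) gchoose (n - m)))"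
proof
  have "integral {0..1} (\<lambda>t. (t - x) gchoose n) =
      (-1) ^ n * integral {0..1}
        (\<lambda>t. \<Sum>m=0..n. (- t gchoose m) * ((x + real n - 1) gchoose (n - m)))"
    unfolding integral_mult_right[symmetric]
    by (intro integral_cong gchoose_diff_expand_neg)
  also have "integral {0..1}
        (\<lambda>t. \<Sum>m=0..n. (- t gchoose m) * ((x + real n - 1) gchoose (n - m))) =
      (\<Sum>m=0..n. integral {0..1} (\<lambda>t. - t gchoose m) * ((x + real n - 1) gchoose (n - m)))"
    by (subst integral_sum)
      (auto intro!: integrable_on_mult_left gchoose_integrable_on continuous_intros)
  finally show "cauchy_poly1 n x = (-1) ^ n * fact n *
      (\<Sum>m=0..n. cauchy_num2 m / fact m * ((x + real n - 1) gchoose (n - m)))"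
    \<comment> \<open>At \<open>x = 0\<close> the integrand is \<open>- t gchoose m\<close>, and the
      factor \<open>fact m\<close> of \<open>cauchy_num2 m\<close> cancels.\<close>
    by (simp add: cauchy_poly1_def cauchy_num2_def cauchy_poly2_def)
next
  have "integral {0..1} (\<lambda>t. (x - t) gchoose n) =
      integral {0..1}
        (\<lambda>t. \<Sum>m=0..n. (-1) ^ m * (t gchoose m) * ((x - real m) gchoose (n - m)))"
    by (intro integral_cong gchoose_diff_expand)
  also have "\<dots> =
      (\<Sum>m=0..n. (-1) ^ m * integral {0..1} (\<lambda>t. t gchoose m) * ((x - real m) gchoose (n - m)))"
    by (subst integral_sum)
      (auto intro!: integrable_on_mult_left integrable_on_mult_right
        gchoose_integrable_on continuous_intros)
  finally show "cauchy_poly2 n x = fact n *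
      (\<Sum>m=0..n. (-1) ^ m * cauchy_num1 m / fact m * ((x - real m) gchoose (n - m)))"
    by (simp add: cauchy_poly2_def cauchy_num1_def cauchy_poly1_def)
qed

end
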